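(* Let $n\ge 1$, $\epsilon>0$, and let $s:[0,1]\times\{0,1\}\to[0,1]$ be a strictly proper scoring rule. The private wagering mechanism with parameters $n,\epsilon,s$ (defined in the context) satisfies all of the following properties (each defined in the context): (a$'$) budget balance in expectation, (b) anonymity, (c) truthfulness, (d) individual rationality, (e) normality, (f) sybilproofness, (g) monotonicity, and (h) $\epsilon$-joint differential privacy.
   Context: Bettors are $\mathcal N=\{1,\dots,n\}$. Bettor $i$ submits a report $p_i\in[0,1]$ (a probability that $\omega=1$) and a wager $m_i\in\mathbb R_+$, where $\mathbb R_+$ denotes the nonnegative reals; $\mathbf p=(p_1,\dots,p_n)$, $\mathbf m=(m_1,\dots,m_n)$; the outcome is $\omega\in\{0,1\}$. A wagering mechanism is given by (possibly randomized) profit functions $\Pi_i(\mathbf p,\mathbf m,\omega)\in\mathbb R$, $i\in\mathcal N$, with $\Pi_i(\mathbf p,\mathbf m,\omega)\ge -m_i$ for all $\mathbf p,\mathbf m,\omega$. The notation $\omega\sim p^*$ means $\Pr[\omega=1]=p^*$. The subscript $-i$ denotes removal of the $i$th coordinate. A function $s$ is a strictly proper scoring rule if for all $p\ne q$ in $[0,1]$, $\mathbb E_{\omega\sim p}[s(p,\omega)]>\mathbb E_{\omega\sim p}[s(q,\omega)]$. Private wagering mechanism. Let $\alpha=1-e^{-\epsilon}$ and $\beta=e^{-\epsilon}$. Given $\mathbf p,\mathbf m,\omega$, draw independently for each $i$ a random variable $x_i(p_i,\omega)$ equal to $1$ with probability $\frac{\alpha s(p_i,\omega)+\beta}{1+\beta}$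 and equal to $-\beta$ with probability $\frac{1-\alpha s(p_i,\omega)}{1+\beta}$. Then $$\Pi_i(\mathbf p,\mathbf m,\omega)=m_i\left(\alpha s(p_i,\omega)-\frac{\sum_{j\in\mathcal N}m_jx_j(p_j,\omega)}{\sum_{j\in\mathcal N}m_j}\right).$$ Properties. Expectations are over the mechanism's randomness and, where indicated, also over $\omega\sim p^*$. (a$'$) Budget balance in expectation: for all $\mathbf p\in[0,1]^n$, $\mathbf m\in\mathbb R_+^n$, $\omega\in\{0,1\}$, $\sum_{i=1}^n\mathbb E[\Pi_i(\mathbf p,\mathbf m,\omega)]=0$. (b) Anonymity: for every permutation $\sigma$ of $\mathcal N$ and all $\mathbf p\in[0,1]^n$, $\mathbf m\in\mathbb R_+^n$, $\omega\in\{0,1\}$, the joint distribution of $\{\Pi_i(\mathbf p,\mathbf m,\omega)\}_{i\in\mathcal N}$ is the same as that of $\{\Pi_{\sigma(i)}((p_{\sigma^{-1}(l)})_{l\in\mathcal N},(m_{\sigma^{-1}(l)})_{l\in\mathcal N},\omega)\}_{i\in\mathcal N}$. (c) Truthfulness: for all $i\in\mathcal N$, all $\mathbf p_{-i}\in[0,1]^{n-1}$, all $\mathbf m\in\mathbb R_+^n$, and all $p^*,p_i\in[0,1]$ with $p_i\ne p^*$, $\mathbb E_{\omega\sim p^*}[\Pi_i((p^*,\mathbf p_{-i}),\mathbf m,\omega)]>\mathbb E_{\omega\sim p^*}[\Pi_i((p_i,\mathbf p_{-i}),\mathbf m,\omega)]$. (d) Individual rationality: for all $i\in\mathcal N$,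 all $m_i>0$ and all $p^*\in[0,1]$ there exists $p_i\in[0,1]$ such that for all $\mathbf p_{-i}\in[0,1]^{n-1}$ and all $\mathbf m_{-i}\in\mathbb R_+^{n-1}$, $\mathbb E_{\omega\sim p^*}[\Pi_i((p_i,\mathbf p_{-i}),\mathbf m,\omega)]\ge 0$. (e) Normality: for all $i\ne j$ in $\mathcal N$, all $\mathbf p,\mathbf p'\in[0,1]^n$ with $p'_k=p_k$ for all $k\neq j$, all $p^*\in[0,1]$ and all $\mathbf m\in\mathbb R_+^n$: if $\mathbb E_{\omega\sim p^*}[\Pi_j(\mathbf p,\mathbf m,\omega)]<\mathbb E_{\omega\sim p^*}[\Pi_j(\mathbf p',\mathbf m,\omega)]$ then $\mathbb E_{\omega\sim p^*}[\Pi_i(\mathbf p,\mathbf m,\omega)]\ge\mathbb E_{\omega\sim p^*}[\Pi_i(\mathbf p',\mathbf m,\omega)]$. (f) Sybilproofness: for all $\mathcal S\subset\mathcal N$, all $\mathbf p$ with $p_i=p_j$ for all $i,j\in\mathcal S$, all $\mathbf m,\mathbf m'\in\mathbb R_+^n$ with $m_i=m_i'$ for $i\notin\mathcal S$ and $\sum_{i\in\mathcal S}m_i=\sum_{i\in\mathcal S}m'_i$, and all $\omega\in\{0,1\}$: $\mathbb E[\Pi_i(\mathbf p,\mathbf m,\omega)]=\mathbb E[\Pi_i(\mathbf p,\mathbf m',\omega)]$ for all $i\notin\mathcal S$, and $\sum_{i\in\mathcal S}\mathbb E[\Pi_i(\mathbf p,\mathbf m,\omega)]=\sum_{i\in\mathcal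 S}\mathbb E[\Pi_i(\mathbf p,\mathbf m',\omega)]$. (g) Monotonicity: for all $i\in\mathcal N$, all $\mathbf p\in[0,1]^n$, all $\mathbf m\in\mathbb R_+^n$, all $M_i>m_i$ and all $p^*\in[0,1]$, either $0<\mathbb E_{\omega\sim p^*}[\Pi_i(\mathbf p,(m_i,\mathbf m_{-i}),\omega)]<\mathbb E_{\omega\sim p^*}[\Pi_i(\mathbf p,(M_i,\mathbf m_{-i}),\omega)]$ or $0>\mathbb E_{\omega\sim p^*}[\Pi_i(\mathbf p,(m_i,\mathbf m_{-i}),\omega)]>\mathbb E_{\omega\sim p^*}[\Pi_i(\mathbf p,(M_i,\mathbf m_{-i}),\omega)]$. (h) $\epsilon$-joint differential privacy (in reports): for all $i\in\mathcal N$, $\mathbf p\in[0,1]^n$, $p_i'\in[0,1]$, $\mathbf m\in\mathbb R_+^n$, $\omega\in\{0,1\}$ and every $\mathcal S\subseteq\mathbb R^{n-1}$, $\Pr[\Pi_{-i}((p_i,\mathbf p_{-i}),\mathbf m,\omega)\in\mathcal S]\le e^{\epsilon}\Pr[\Pi_{-i}((p_i',\mathbf p_{-i}),\mathbf m,\omega)\in\mathcal S]$, where $\Pi_{-i}$ is the vector of profits of all bettors other than $i$.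
   Formalization: Truthfulness is claimed only when m_i > 0 and some other wager is positive; monotonicity only when m_i > 0, and it also allows expected profit zero both before and after the increase. As stated, both fail, e.g. for n = 1, where the expected profit is always 0. *)

theory Defs
  imports "HOL-Probability.Probability" "HOL-Probability.Product_PMF"
begin

text \<open>
  The bettors are the elements of a finite type \<open>'n\<close>, so \<open>n = CARD('n) \<ge> 1\<close>. The outcome is a
  \<^typ>\<open>bool\<close>, with \<^term>\<open>True\<close> for \<open>\<omega> = 1\<close>, so that \<open>\<omega> \<sim> p\<close> is \<^term>\<open>bernoulli_pmf p\<close>.
  A randomized mechanism maps reports, wagers and the outcome to the joint law of the
  profit vector.
\<close>

type_synonym 'n mechanism =
  "('n \<Rightarrow> real) \<Rightarrow> ('n \<Rightarrow> real) \<Rightarrow> bool \<Rightarrow> ('n \<Rightarrow> real) pmf"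

definition reports :: "('n \<Rightarrow> real) set" where
  "reports = {p. \<forall>i. p i \<in> {0..1}}"

definition wagers :: "('n \<Rightarrow> real) set" where
  "wagers = {m. \<forall>i. 0 \<le> m i}"

definition strictly_proper :: "(real \<Rightarrow> bool \<Rightarrow> real) \<Rightarrow> bool" where
  "strictly_proper s \<longleftrightarrow>
    (\<forall>p\<in>{0..1}. \<forall>q\<in>{0..1}. p \<noteq> q \<longrightarrow>
      measure_pmf.expectation (bernoulli_pmf p) (s p) >
      measure_pmf.expectation (bernoulli_pmf p) (s q))"

text \<open>
  For \<open>s p \<omega> \<in> [0, 1]\<close> the Bernoulli parameter below lies in \<open>[0, 1]\<close>, and the value
  \<open>- \<beta>\<close> has the complementary probability \<open>(1 - \<alpha> s(p, \<omega>)) / (1 + \<beta>)\<close> because \<open>\<alpha> + \<beta> = 1\<close>.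
\<close>

definition x_pmf :: "(real \<Rightarrow> bool \<Rightarrow> real) \<Rightarrow> real \<Rightarrow> real \<Rightarrow> bool \<Rightarrow> real pmf" where
  "x_pmf s \<epsilon> p \<omega> =
    (let \<alpha> = 1 - exp (- \<epsilon>); \<beta> = exp (- \<epsilon>) in
     map_pmf (\<lambda>b. if b then 1 else - \<beta>) (bernoulli_pmf ((\<alpha> * s p \<omega> + \<beta>) / (1 + \<beta>))))"

text \<open>
  If all wagers are zero, the quotient below is \<open>0 / 0 = 0\<close>; every profit is then zero because
  of the leading factor \<open>m i\<close>.
\<close>

definition private_wagering ::
    "(real \<Rightarrow> bool \<Rightarrow> real) \<Rightarrow> real \<Rightarrow> 'n :: finite mechanism" where
  "private_wagering s \<epsilon> p m \<omega> =
    (let \<alpha> = 1 - exp (- \<epsilon>) in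
     map_pmf (\<lambda>x i. m i * (\<alpha> * s (p i) \<omega> - (\<Sum>j\<in>UNIV. m j * x j) / (\<Sum>j\<in>UNIV. m j)))
       (Pi_pmf UNIV 0 (\<lambda>j. x_pmf s \<epsilon> (p j) \<omega>)))"

definition exp_profit ::
    "'n mechanism \<Rightarrow> ('n \<Rightarrow> real) \<Rightarrow> ('n \<Rightarrow> real) \<Rightarrow> bool \<Rightarrow> 'n \<Rightarrow> real" where
  "exp_profit W p m \<omega> i = measure_pmf.expectation (W p m \<omega>) (\<lambda>y. y i)"

definition exp_profit_under ::
    "real \<Rightarrow> 'n mechanism \<Rightarrow> ('n \<Rightarrow> real) \<Rightarrow> ('n \<Rightarrow> real) \<Rightarrow> 'n \<Rightarrow> real" where
  "exp_profit_under q W p m i =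
    measure_pmf.expectation (bind_pmf (bernoulli_pmf q) (W p m)) (\<lambda>y. y i)"

definition budget_balanced_in_expectation :: "'n :: finite mechanism \<Rightarrow> bool" where
  "budget_balanced_in_expectation W \<longleftrightarrow>
    (\<forall>p\<in>reports. \<forall>m\<in>wagers. \<forall>\<omega>. (\<Sum>i\<in>UNIV. exp_profit W p m \<omega> i) = 0)"

definition anonymous :: "'n mechanism \<Rightarrow> bool" where
  "anonymous W \<longleftrightarrow>
    (\<forall>\<sigma>. bij \<sigma> \<longrightarrow> (\<forall>p\<in>reports. \<forall>m\<in>wagers. \<forall>\<omega>.
      W p m \<omega> =
      map_pmf (\<lambda>y i. y (\<sigma> i)) (W (\<lambda>l. p (inv \<sigma> l)) (\<lambda>l. m (inv \<sigma> l)) \<omega>)))"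

text \<open>
  The strict inequality is required where bettor \<open>i\<close> has something at stake against someone:
  \<open>m i > 0\<close> and some other wager is positive. Without this guard the property fails for the
  mechanism above: if \<open>m i = 0\<close>, or if \<open>m j = 0\<close> for all \<open>j \<noteq> i\<close> (in particular if \<open>n = 1\<close>),
  the expected profit of \<open>i\<close> is zero whatever the reports are.
\<close>

definition truthful :: "'n mechanism \<Rightarrow> bool" where
  "truthful W \<longleftrightarrow>
    (\<forall>i. \<forall>p\<in>reports. \<forall>m\<in>wagers. \<forall>q\<in>{0..1}. \<forall>r\<in>{0..1}.
      m i > 0 \<and> (\<exists>j. j \<noteq> i \<and> m j > 0) \<longrightarrow> r \<noteq> q \<longrightarrow>
      exp_profit_under q W (p(i := q)) m i > exp_profit_under q W (p(i := r)) m i)"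

definition individually_rational :: "'n mechanism \<Rightarrow> bool" where
  "individually_rational W \<longleftrightarrow>
    (\<forall>i. \<forall>w>0. \<forall>q\<in>{0..1}. \<exists>r\<in>{0..1}. \<forall>p\<in>reports. \<forall>m\<in>wagers.
      exp_profit_under q W (p(i := r)) (m(i := w)) i \<ge> 0)"

definition normal_mechanism :: "'n mechanism \<Rightarrow> bool" where
  "normal_mechanism W \<longleftrightarrow>
    (\<forall>i j. i \<noteq> j \<longrightarrow>
      (\<forall>p\<in>reports. \<forall>p'\<in>reports. (\<forall>k. k \<noteq> j \<longrightarrow> p' k = p k) \<longrightarrow>
        (\<forall>q\<in>{0..1}. \<forall>m\<in>wagers.
          exp_profit_under q W p m j < exp_profit_under q W p' m j \<longrightarrow>
          exp_profit_under q W p m i \<ge> exp_profit_under q W p' m i)))"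

definition sybilproof :: "'n :: finite mechanism \<Rightarrow> bool" where
  "sybilproof W \<longleftrightarrow>
    (\<forall>S :: 'n set. \<forall>p\<in>reports. (\<forall>i\<in>S. \<forall>j\<in>S. p i = p j) \<longrightarrow>
      (\<forall>m\<in>wagers. \<forall>m'\<in>wagers.
        (\<forall>i. i \<notin> S \<longrightarrow> m i = m' i) \<and> (\<Sum>i\<in>S. m i) = (\<Sum>i\<in>S. m' i) \<longrightarrow>
        (\<forall>\<omega>. (\<forall>i. i \<notin> S \<longrightarrow> exp_profit W p m \<omega> i = exp_profit W p m' \<omega> i) \<and>
             (\<Sum>i\<in>S. exp_profit W p m \<omega> i) = (\<Sum>i\<in>S. exp_profit W p m' \<omega> i))))"

text \<open>
  The wager being increased is positive, and the strict alternatives leave room for the case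
  that the expected profit is zero before and after the increase. That case does occur for the
  mechanism above, for example when all reports agree or when \<open>n = 1\<close>; and for \<open>m i = 0\<close> the
  expected profit before the increase is zero, which rules out both strict alternatives.
\<close>

definition monotonic :: "'n mechanism \<Rightarrow> bool" where
  "monotonic W \<longleftrightarrow>
    (\<forall>i. \<forall>p\<in>reports. \<forall>m\<in>wagers. \<forall>M>m i. \<forall>q\<in>{0..1}. m i > 0 \<longrightarrow>
      (let E = exp_profit_under q W p m i;
           E' = exp_profit_under q W p (m(i := M)) i
       in 0 < E \<and> E < E' \<or> 0 > E \<and> E > E' \<or> 0 = E \<and> E = E'))"

text \<open>Profit vectors of the bettors other than \<open>i\<close> are functions restricted to \<open>- {i}\<close>.\<close>

definition joint_differentially_private :: "real \<Rightarrow> 'n mechanism \<Rightarrow> bool" where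
  "joint_differentially_private \<epsilon> W \<longleftrightarrow>
    (\<forall>i. \<forall>p\<in>reports. \<forall>r\<in>{0..1}. \<forall>m\<in>wagers. \<forall>\<omega>. \<forall>S.
      measure_pmf.prob (map_pmf (\<lambda>y. restrict y (- {i})) (W p m \<omega>)) S \<le>
      exp \<epsilon> * measure_pmf.prob (map_pmf (\<lambda>y. restrict y (- {i})) (W (p(i := r)) m \<omega>)) S)"

end

theory Submission
  imports Defs
begin

text \<open>
  Since \<open>\<alpha> + \<beta> = 1\<close>, the noisy score \<open>x\<^sub>i\<close> has mean \<open>\<alpha> s(p\<^sub>i, \<omega>)\<close>, so in expectation the
  mechanism is, up to the factor \<open>\<alpha>\<close>, the weighted score wagering mechanism, in which bettor
  \<open>i\<close> earns \<open>m\<^sub>i\<close> times the amount by which her score exceeds the wager-weighted average score.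
  All properties except anonymity and privacy are elementary facts about this deterministic
  payoff. Privacy holds because the others' profits depend on \<open>p\<^sub>i\<close> only through \<open>x\<^sub>i\<close>,
  and both atoms of \<open>x\<^sub>i\<close> have mass between \<open>\<beta> / (1 + \<beta>)\<close> and \<open>1 / (1 + \<beta>)\<close>.
\<close>

section \<open>Weighted score payoffs\<close>

text \<open>The scores \<open>t\<close> are arbitrary reals, so that realized scores at a fixed
  outcome and scores averaged over the outcome are both instances. If all wagers vanish, the
  quotient is \<open>0 / 0 = 0\<close> and the payoff is 0.\<close>

definition weighted_score_payoff :: "('n :: finite \<Rightarrow> real) \<Rightarrow> ('n \<Rightarrow> real) \<Rightarrow> 'n \<Rightarrow> real" where
  "weighted_score_payoff m t i = m i * (t i - (\<Sum>j\<in>UNIV. m j * t j) / (\<Sum>j\<in>UNIV. m j))"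

lemma wagers_sum_eq_0_iff:
  assumes "m \<in> wagers"
  shows "(\<Sum>j\<in>(UNIV :: 'n :: finite set). m j) = 0 \<longleftrightarrow> (\<forall>j. m j = 0)"
  using assms by (subst sum_nonneg_eq_0_iff) (auto simp: wagers_def)

text \<open>Bettor \<open>i\<close>'s own term cancels against the average, which leaves pairwise
  comparisons with the others over a denominator free of scores. The comparison lemmas below read
  off from this form how the payoff depends on \<open>t\<close> and on \<open>m i\<close>. With zero
  total wager both sides vanish because \<open>m i = 0\<close>.\<close>

lemma weighted_score_payoff_eq:
  assumes "m \<in> wagers"
  shows "weighted_score_payoff m t i =
    m i * (\<Sum>j\<in>UNIV - {i}. m j * (t i - t j)) / (m i + (\<Sum>j\<in>UNIV - {i}. m j))"
proof -
  have M: "(\<Sum>j\<in>UNIV. m j) = m i + (\<Sum>j\<in>UNIV - {i}. m j)"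
    and T: "(\<Sum>j\<in>UNIV. m j * t j) = m i * t i + (\<Sum>j\<in>UNIV - {i}. m j * t j)"
    by (subst sum.remove[of _ i]; simp)+
  have D: "(\<Sum>j\<in>UNIV - {i}. m j * (t i - t j)) =
      (\<Sum>j\<in>UNIV - {i}. m j) * t i - (\<Sum>j\<in>UNIV - {i}. m j * t j)"
    by (simp add: right_diff_distrib sum_subtractf sum_distrib_right)
  show ?thesis
  proof (cases "(\<Sum>j\<in>UNIV. m j) = 0")
    case True
    then have "m i = 0" using wagers_sum_eq_0_iff[OF assms] by blast
    then show ?thesis by (simp add: weighted_score_payoff_def)
  next
    case False
    then show ?thesis
      unfolding weighted_score_payoff_def D T M by (simp add: field_simps)
  qed
qed

lemma sum_weighted_score_payoff:
  assumes "m \<in> wagers"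
  shows "(\<Sum>i\<in>UNIV. weighted_score_payoff m t i) = 0"
proof (cases "(\<Sum>j\<in>UNIV. m j) = 0")
  case True
  then show ?thesis
    using wagers_sum_eq_0_iff[OF assms] by (simp add: weighted_score_payoff_def)
next
  case False
  then show ?thesis
    unfolding weighted_score_payoff_def right_diff_distrib sum_subtractf
      sum_distrib_right[symmetric] by simp
qed

text \<open>A higher own score enlarges every pairwise difference; the positive wager of
  \<open>j\<close> makes one weighted difference grow strictly, and \<open>m i > 0\<close> carries
  this over to the payoff.\<close>

lemma weighted_score_payoff_strict_mono:
  assumes m: "m \<in> wagers" and "m i > 0" and "j \<noteq> i" "m j > 0"
    and "\<And>k. k \<noteq> i \<Longrightarrow> t' k = t k" and "t i < t' i"
  shows "weighted_score_payoff m t i < weighted_score_payoff m t' i"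
proof -
  have nonneg: "m k \<ge> 0" for k using m by (simp add: wagers_def)
  have "(\<Sum>k\<in>UNIV - {i}. m k * (t i - t k)) < (\<Sum>k\<in>UNIV - {i}. m k * (t' i - t' k))"
  proof (rule sum_strict_mono_ex1)
    show "\<forall>k\<in>UNIV - {i}. m k * (t i - t k) \<le> m k * (t' i - t' k)"
      using assms nonneg by (auto intro!: mult_left_mono)
    show "\<exists>k\<in>UNIV - {i}. m k * (t i - t k) < m k * (t' i - t' k)"
      using assms by (intro bexI[of _ j]) (auto intro!: mult_strict_left_mono)
  qed simp
  moreover have "m i + (\<Sum>k\<in>UNIV - {i}. m k) > 0"
    using \<open>m i > 0\<close> by (intro add_pos_nonneg sum_nonneg nonneg)
  ultimately show ?thesis
    unfolding weighted_score_payoff_eq[OF m] using \<open>m i > 0\<close>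
    by (intro divide_strict_right_mono mult_strict_left_mono)
qed

lemma weighted_score_payoff_nonneg:
  assumes m: "m \<in> wagers" and "\<And>j. t j \<le> t i"
  shows "0 \<le> weighted_score_payoff m t i"
  unfolding weighted_score_payoff_eq[OF m]
  using assms by (intro divide_nonneg_nonneg mult_nonneg_nonneg add_nonneg_nonneg sum_nonneg)
    (auto simp: wagers_def)

text \<open>The weak form holds for all nonnegative wagers. Normality uses its contrapositive: a
  strictly larger payoff forces a higher own score.\<close>

lemma weighted_score_payoff_mono:
  assumes m: "m \<in> wagers" and "\<And>k. k \<noteq> i \<Longrightarrow> t' k = t k" and "t i \<le> t' i"
  shows "weighted_score_payoff m t i \<le> weighted_score_payoff m t' i"
  unfolding weighted_score_payoff_eq[OF m]
  using assms
  by (intro divide_right_mono mult_left_mono sum_mono add_nonneg_nonneg sum_nonneg)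
    (auto simp: wagers_def)

text \<open>The score of another bettor \<open>j\<close> occurs in the payoff of \<open>i\<close>
  only in the difference \<open>t i - t j\<close>, with a nonnegative weight.\<close>

lemma weighted_score_payoff_antimono:
  assumes m: "m \<in> wagers" and "i \<noteq> j" and "\<And>k. k \<noteq> j \<Longrightarrow> t' k = t k" and "t j \<le> t' j"
  shows "weighted_score_payoff m t' i \<le> weighted_score_payoff m t i"
proof -
  have "m k * (t' i - t' k) \<le> m k * (t i - t k)" for k
    using assms by (cases "k = j") (auto simp: wagers_def intro!: mult_left_mono)
  then have "(\<Sum>k\<in>UNIV - {i}. m k * (t' i - t' k)) \<le> (\<Sum>k\<in>UNIV - {i}. m k * (t i - t k))"
    by (intro sum_mono)
  then show ?thesis
    unfolding weighted_score_payoff_eq[OF m]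
    using m by (intro divide_right_mono mult_left_mono add_nonneg_nonneg sum_nonneg)
      (auto simp: wagers_def)
qed

text \<open>The payoff is \<open>m i / (m i + R) * D\<close>, where neither \<open>R\<close> nor
  \<open>D\<close> involves the wager of \<open>i\<close>. For \<open>R > 0\<close> the factor is
  positive and strictly increasing in that wager, so the sign of \<open>D\<close> selects the
  alternative.\<close>

lemma weighted_score_payoff_increase_wager:
  fixes m t :: "'n :: finite \<Rightarrow> real"
  assumes m: "m \<in> wagers" and pos: "m i > 0" and less: "m i < M"
  defines "E \<equiv> weighted_score_payoff m t i"
    and "E' \<equiv> weighted_score_payoff (m(i := M)) t i"
  shows "0 < E \<and> E < E' \<or> 0 > E \<and> E > E' \<or> 0 = E \<and> E = E'"
proof -
  define D where "D = (\<Sum>j\<in>UNIV - {i}. m j * (t i - t j))"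
  define R where "R = (\<Sum>j\<in>UNIV - {i}. m j)"
  have R: "R \<ge> 0" unfolding R_def using m by (intro sum_nonneg) (auto simp: wagers_def)
  have m': "m(i := M) \<in> wagers" using m pos less by (auto simp: wagers_def)
  have E: "E = m i / (m i + R) * D"
    unfolding E_def D_def R_def weighted_score_payoff_eq[OF m] by simp
  have E': "E' = M / (M + R) * D"
    unfolding E'_def D_def R_def weighted_score_payoff_eq[OF m'] by simp
  show ?thesis
  proof (cases "R = 0")
    \<comment> \<open>Nobody else has a stake, so \<open>D\<close> vanishes as well and both payoffs
      are zero.\<close>
    case True
    then have "\<forall>j\<in>UNIV - {i}. m j = 0"
      unfolding R_def using m by (subst (asm) sum_nonneg_eq_0_iff) (auto simp: wagers_def)
    then have "D = 0" by (simp add: D_def)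
    then show ?thesis using E E' by simp
  next
    case False
    with R have "R > 0" by simp
    then have c: "0 < m i / (m i + R)" "m i / (m i + R) < M / (M + R)"
      using pos less by (simp_all add: field_simps)
    consider "D = 0" | "D > 0" | "D < 0" by linarith
    then show ?thesis
    proof cases
      case 1
      then show ?thesis by (simp add: E E')
    next
      case 2
      then show ?thesis
        unfolding E E' by (intro disjI1 conjI mult_pos_pos mult_strict_right_mono c)
    next
      case 3
      then show ?thesis
        unfolding E E'
        by (intro disjI2 disjI1 conjI mult_pos_neg mult_strict_right_mono_neg c)
    qed
  qed
qed

text \<open>With a common score \<open>c\<close> on \<open>S\<close>, the wagers inside
  \<open>S\<close> enter the total wager and the weighted score sum only through their sum over
  \<open>S\<close>, so redistributing them leaves the average score unchanged.\<close>

lemma weighted_score_payoff_cong_sybils: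
  assumes eq: "\<And>i j. i \<in> S \<Longrightarrow> j \<in> S \<Longrightarrow> t i = t j"
    and out: "\<And>i. i \<notin> S \<Longrightarrow> m i = m' i"
    and sum: "(\<Sum>i\<in>S. m i) = (\<Sum>i\<in>S. m' i)"
  shows "i \<notin> S \<Longrightarrow> weighted_score_payoff m t i = weighted_score_payoff m' t i"
    and "(\<Sum>i\<in>S. weighted_score_payoff m t i) = (\<Sum>i\<in>S. weighted_score_payoff m' t i)"
proof -
  obtain c where c: "\<And>i. i \<in> S \<Longrightarrow> t i = c" using eq by metis
  have split: "(\<Sum>j\<in>UNIV. f j) = (\<Sum>j\<in>-S. f j) + (\<Sum>j\<in>S. f j)" for f :: "'a \<Rightarrow> real"
    using sum.subset_diff[of S UNIV f] by (simp add: Compl_eq_Diff_UNIV)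
  have S: "(\<Sum>i\<in>S. w i * t i) = (\<Sum>i\<in>S. w i) * c" for w
    by (simp add: c sum_distrib_right)
  have M: "(\<Sum>j\<in>UNIV. m j) = (\<Sum>j\<in>UNIV. m' j)"
    and T: "(\<Sum>j\<in>UNIV. m j * t j) = (\<Sum>j\<in>UNIV. m' j * t j)"
    by (simp_all add: split S sum out)
  show "i \<notin> S \<Longrightarrow> weighted_score_payoff m t i = weighted_score_payoff m' t i"
    by (simp add: weighted_score_payoff_def M T out)
  show "(\<Sum>i\<in>S. weighted_score_payoff m t i) = (\<Sum>i\<in>S. weighted_score_payoff m' t i)"
    by (simp add: weighted_score_payoff_def M T c sum flip: sum_distrib_right)
qed

section \<open>Products of probability mass functions\<close>

text \<open>Summing the pointwise bound over \<open>A\<close>, written as an integral over counting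
  measure so that \<open>A\<close> may be any set. This turns a bound on atoms into the bound on
  events that privacy asks for.\<close>

lemma measure_pmf_le_mult_measure_pmf:
  assumes "\<And>x. pmf p x \<le> c * pmf q x" and "c \<ge> 0"
  shows "measure_pmf.prob p A \<le> c * measure_pmf.prob q A"
proof -
  have "emeasure p A = (\<integral>\<^sup>+x. ennreal (pmf p x) \<partial>count_space A)"
    by (simp add: nn_integral_pmf)
  also have "\<dots> \<le> (\<integral>\<^sup>+x. ennreal c * ennreal (pmf q x) \<partial>count_space A)"
    using assms by (intro nn_integral_mono) (simp flip: ennreal_mult)
  also have "\<dots> = ennreal c * emeasure q A"
    by (simp add: nn_integral_cmult nn_integral_pmf)
  finally show ?thesis
    using \<open>c \<ge> 0\<close> by (simp add: measure_pmf.emeasure_eq_measure flip: ennreal_mult)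
qed

lemma Pi_pmf_reindex:
  fixes \<sigma> :: "'n :: finite \<Rightarrow> 'n" and d :: 'a
  assumes "bij \<sigma>"
  shows "Pi_pmf UNIV d X = map_pmf (\<lambda>x i. x (\<sigma> i)) (Pi_pmf UNIV d (\<lambda>j. X (inv \<sigma> j)))"
proof (rule pmf_eqI)
  fix y :: "'n \<Rightarrow> 'a"
  \<comment> \<open>By injectivity the mass of the image law at \<open>y\<close> is the mass at its
    single preimage, \<open>y\<close> composed with \<open>inv \<sigma>\<close>.\<close>
  have inj: "inj (\<lambda>(x :: 'n \<Rightarrow> 'a) i. x (\<sigma> i))"
  proof (intro injI ext)
    fix x x' :: "'n \<Rightarrow> 'a" and j
    assume "(\<lambda>i. x (\<sigma> i)) = (\<lambda>i. x' (\<sigma> i))"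
    then have "x (\<sigma> (inv \<sigma> j)) = x' (\<sigma> (inv \<sigma> j))" by (rule fun_cong)
    then show "x j = x' j" using assms by (simp add: bij_is_surj surj_f_inv_f)
  qed
  have "pmf (map_pmf (\<lambda>x i. x (\<sigma> i)) (Pi_pmf UNIV d (\<lambda>j. X (inv \<sigma> j)))) y =
      pmf (Pi_pmf UNIV d (\<lambda>j. X (inv \<sigma> j))) (\<lambda>j. y (inv \<sigma> j))"
    using pmf_map_inj'[OF inj, of _ "\<lambda>j. y (inv \<sigma> j)"] assms by (simp add: bij_is_inj)
  also have "\<dots> = (\<Prod>j\<in>UNIV. pmf (X (inv \<sigma> j)) (y (inv \<sigma> j)))"
    by (simp add: pmf_Pi)
  also have "\<dots> = (\<Prod>j\<in>UNIV. pmf (X j) (y j))"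
    using bij_imp_bij_inv[OF assms]
    by (intro prod.reindex_bij_betw) simp
  also have "\<dots> = pmf (Pi_pmf UNIV d X) y"
    by (simp add: pmf_Pi)
  finally show "pmf (Pi_pmf UNIV d X) y =
      pmf (map_pmf (\<lambda>x i. x (\<sigma> i)) (Pi_pmf UNIV d (\<lambda>j. X (inv \<sigma> j)))) y" ..
qed

text \<open>The mass of a product law is a product of masses, and the two laws differ only in the
  factor at \<open>i\<close>.\<close>

lemma pmf_Pi_pmf_upd_le:
  fixes i :: "'n :: finite"
  assumes "\<And>v. pmf (X i) v \<le> c * pmf Y v"
  shows "pmf (Pi_pmf UNIV d X) y \<le> c * pmf (Pi_pmf UNIV d (X(i := Y))) y"
proof -
  have split: "pmf (Pi_pmf UNIV d Z) y = pmf (Z i) (y i) * (\<Prod>j\<in>UNIV - {i}. pmf (Z j) (y j))"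
    for Z by (simp add: pmf_Pi) (rule prod.remove; simp)
  have "pmf (Pi_pmf UNIV d X) y = pmf (X i) (y i) * (\<Prod>j\<in>UNIV - {i}. pmf (X j) (y j))"
    by (rule split)
  also have "\<dots> \<le> (c * pmf Y (y i)) * (\<Prod>j\<in>UNIV - {i}. pmf (X j) (y j))"
    by (intro mult_right_mono assms prod_nonneg) simp
  also have "(\<Prod>j\<in>UNIV - {i}. pmf (X j) (y j)) = (\<Prod>j\<in>UNIV - {i}. pmf ((X(i := Y)) j) (y j))"
    by (intro prod.cong) auto
  also have "c * pmf Y (y i) * \<dots> = c * pmf (Pi_pmf UNIV d (X(i := Y))) y"
    by (simp add: split)
  finally show ?thesis .
qed

section \<open>The private wagering mechanism\<close>

text \<open>For \<open>q\<close> in [0, 1] this is the expectation of \<open>s r\<close> under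
  \<open>bernoulli_pmf q\<close>; the explicit affine form makes the linear algebra direct.\<close>

definition expected_score :: "(real \<Rightarrow> bool \<Rightarrow> real) \<Rightarrow> real \<Rightarrow> real \<Rightarrow> real" where
  "expected_score s q r = q * s r True + (1 - q) * s r False"

lemma strictly_properD:
  assumes "strictly_proper s" "q \<in> {0..1}" "r \<in> {0..1}" "r \<noteq> q"
  shows "expected_score s q r < expected_score s q q"
proof -
  have "measure_pmf.expectation (bernoulli_pmf q) (s r) <
      measure_pmf.expectation (bernoulli_pmf q) (s q)"
    using assms unfolding strictly_proper_def by metis
  moreover have "measure_pmf.expectation (bernoulli_pmf q) f = q * f True + (1 - q) * f False"
    for f :: "bool \<Rightarrow> real" using assms(2) by simp
  ultimately show ?thesis by (simp add: expected_score_def)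
qed

context
  fixes \<epsilon> :: real and s :: "real \<Rightarrow> bool \<Rightarrow> real"
  assumes \<epsilon>: "\<epsilon> > 0" and s: "\<And>p \<omega>. p \<in> {0..1} \<Longrightarrow> s p \<omega> \<in> {0..1}"
begin

section \<open>The law of the noisy score\<close>

lemma x_pmf_param:
  assumes "r \<in> {0..1}"
  shows "exp (- \<epsilon>) \<le> (1 - exp (- \<epsilon>)) * s r \<omega> + exp (- \<epsilon>)"
    and "(1 - exp (- \<epsilon>)) * s r \<omega> + exp (- \<epsilon>) \<le> 1"
proof -
  have "0 \<le> s r \<omega>" "s r \<omega> \<le> 1" using s[OF assms] by auto
  moreover have "0 \<le> 1 - exp (- \<epsilon>)" using \<epsilon> by simp
  ultimately have "0 \<le> (1 - exp (- \<epsilon>)) * s r \<omega>" "(1 - exp (- \<epsilon>)) * s r \<omega> \<le> 1 - exp (- \<epsilon>)"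
    by (simp_all add: mult_left_le)
  then show "exp (- \<epsilon>) \<le> (1 - exp (- \<epsilon>)) * s r \<omega> + exp (- \<epsilon>)"
    "(1 - exp (- \<epsilon>)) * s r \<omega> + exp (- \<epsilon>) \<le> 1" by simp_all
qed

text \<open>\<open>bernoulli_pmf\<close> clamps its parameter to [0, 1], so this membership is what
  makes the intended masses the actual ones.\<close>

lemma x_pmf_param_prob:
  assumes "r \<in> {0..1}"
  shows "((1 - exp (- \<epsilon>)) * s r \<omega> + exp (- \<epsilon>)) / (1 + exp (- \<epsilon>)) \<in> {0..1}"
proof -
  have "0 < exp (- \<epsilon>)" by simp
  then show ?thesis
    using x_pmf_param[OF assms, of \<omega>]
    by (intro atLeastAtMost_iff[THEN iffD2] conjI divide_nonneg_pos divide_le_eq_1_pos[THEN iffD2])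
      linarith+
qed

lemma finite_set_x_pmf: "finite (set_pmf (x_pmf s \<epsilon> r \<omega>))"
  by (simp add: x_pmf_def Let_def)

text \<open>With success probability \<open>\<pi>\<close> the mean is \<open>\<pi> - (1 - \<pi>) *
  \<beta> = \<pi> * (1 + \<beta>) - \<beta>\<close>, and the parameter is chosen so that the two
  terms \<open>\<beta>\<close> cancel.\<close>

lemma expectation_x_pmf:
  assumes "r \<in> {0..1}"
  shows "measure_pmf.expectation (x_pmf s \<epsilon> r \<omega>) (\<lambda>v. v) = (1 - exp (- \<epsilon>)) * s r \<omega>"
proof -
  define \<beta> where "\<beta> = exp (- \<epsilon>)"
  define \<pi> where "\<pi> = ((1 - \<beta>) * s r \<omega> + \<beta>) / (1 + \<beta>)"
  have "\<beta> > 0" by (simp add: \<beta>_def)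
  then have mass: "\<pi> * (1 + \<beta>) = (1 - \<beta>) * s r \<omega> + \<beta>" by (simp add: \<pi>_def)
  have "\<pi> \<in> {0..1}"
    using x_pmf_param_prob[OF assms, of \<omega>] unfolding \<pi>_def \<beta>_def .
  then have "measure_pmf.expectation (x_pmf s \<epsilon> r \<omega>) (\<lambda>v. v) = \<pi> * (1 + \<beta>) - \<beta>"
    unfolding x_pmf_def Let_def \<beta>_def[symmetric] \<pi>_def[symmetric]
    by (simp add: algebra_simps)
  then show ?thesis unfolding mass by (simp add: \<beta>_def)
qed

text \<open>Masses between \<open>\<beta> / (1 + \<beta>)\<close> and
  \<open>1 / (1 + \<beta>)\<close> have ratio at most
  \<open>1 / \<beta> = exp \<epsilon>\<close>.\<close>

lemma pmf_x_pmf_le: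
  assumes "r \<in> {0..1}" "r' \<in> {0..1}"
  shows "pmf (x_pmf s \<epsilon> r \<omega>) v \<le> exp \<epsilon> * pmf (x_pmf s \<epsilon> r' \<omega>) v"
proof -
  define \<beta> where "\<beta> = exp (- \<epsilon>)"
  define a where "a r = (1 - \<beta>) * s r \<omega> + \<beta>" for r
  have \<beta>: "\<beta> > 0" and e: "exp \<epsilon> = 1 / \<beta>" by (simp_all add: \<beta>_def exp_minus field_simps)
  have a: "\<beta> \<le> a u" "a u \<le> 1" if "u \<in> {0..1}" for u
    using x_pmf_param[OF that] by (simp_all add: a_def \<beta>_def)
  have atoms: "pmf (bernoulli_pmf (a r / (1 + \<beta>))) b \<le>
      exp \<epsilon> * pmf (bernoulli_pmf (a r' / (1 + \<beta>))) b" for b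
  proof -
    have prob: "a u / (1 + \<beta>) \<in> {0..1}" if "u \<in> {0..1}" for u
      using a[OF that] \<beta> by simp
    have bound: "x / (1 + \<beta>) \<le> exp \<epsilon> * (y / (1 + \<beta>))" if "x \<le> 1" "\<beta> \<le> y" for x y
    proof -
      have "1 \<le> y / \<beta>" using that \<beta> by simp
      with \<open>x \<le> 1\<close> have "x \<le> y / \<beta>" by linarith
      then have "x / (1 + \<beta>) \<le> y / \<beta> / (1 + \<beta>)" using \<beta> by (intro divide_right_mono) auto
      then show ?thesis by (simp add: e)
    qed
    show ?thesis
    proof (cases b)
      case True
      then show ?thesis
        using bound[of "a r" "a r'"] a prob assms by simp
    next
      case False
      \<comment> \<open>The numerator \<open>1 + \<beta> - a u\<close> of the failure mass again
        lies between \<open>\<beta>\<close> and 1, since \<open>a u\<close> does.\<close>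
      have "1 - a u / (1 + \<beta>) = (1 + \<beta> - a u) / (1 + \<beta>)" for u
        using \<beta> by (simp add: field_simps)
      then show ?thesis
        using bound[of "1 + \<beta> - a r" "1 + \<beta> - a r'"] a prob assms False by simp
    qed
  qed
  have inj: "inj (\<lambda>b. if b then 1 else - \<beta>)" using \<beta> by (auto simp: inj_def)
  have x: "x_pmf s \<epsilon> u \<omega> = map_pmf (\<lambda>b. if b then 1 else - \<beta>) (bernoulli_pmf (a u / (1 + \<beta>)))"
    for u unfolding x_pmf_def Let_def a_def \<beta>_def ..
  \<comment> \<open>Passing to the preimage of \<open>{v}\<close> treats both atoms and every other
    value \<open>v\<close>, whose preimage is empty, at once.\<close>
  have "measure_pmf.prob (x_pmf s \<epsilon> r \<omega>) {v} \<le> exp \<epsilon> * measure_pmf.prob (x_pmf s \<epsilon> r' \<omega>) {v}"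
    unfolding x measure_map_pmf by (intro measure_pmf_le_mult_measure_pmf atoms) simp
  then show ?thesis by (simp add: measure_pmf_single)
qed

section \<open>Expected profits\<close>

lemma finite_set_noise:
  fixes p :: "'n :: finite \<Rightarrow> real"
  shows "finite (set_pmf (Pi_pmf UNIV 0 (\<lambda>j. x_pmf s \<epsilon> (p j) \<omega>)))"
  by (rule finite_subset[OF set_Pi_pmf_subset']) (auto intro!: finite_set_x_pmf)

text \<open>The profit is affine in the noise vector, so each noisy score may be replaced by its
  mean; the common factor \<alpha> then comes out.\<close>

lemma exp_profit_private_wagering:
  fixes p :: "'n :: finite \<Rightarrow> real"
  assumes p: "p \<in> reports"
  shows "exp_profit (private_wagering s \<epsilon>) p m \<omega> i =
    (1 - exp (- \<epsilon>)) * weighted_score_payoff m (\<lambda>j. s (p j) \<omega>) i"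
proof -
  define \<alpha> where "\<alpha> = 1 - exp (- \<epsilon>)"
  define P where "P = Pi_pmf UNIV 0 (\<lambda>j. x_pmf s \<epsilon> (p j) \<omega>)"
  have int: "integrable (measure_pmf P) f" for f :: "_ \<Rightarrow> real"
    unfolding P_def by (intro integrable_measure_pmf_finite finite_set_noise)
  have comp: "measure_pmf.expectation P (\<lambda>x. x j) = \<alpha> * s (p j) \<omega>" for j
  proof -
    have "measure_pmf.expectation P (\<lambda>x. x j) =
        measure_pmf.expectation (map_pmf (\<lambda>x. x j) P) (\<lambda>v. v)" by simp
    \<comment> \<open>The index set is \<open>UNIV\<close>, so the default value 0 of
      \<open>Pi_pmf\<close> never appears in a marginal.\<close>
    also have "map_pmf (\<lambda>x. x j) P = x_pmf s \<epsilon> (p j) \<omega>"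
      unfolding P_def by (subst Pi_pmf_component) auto
    also have "measure_pmf.expectation \<dots> (\<lambda>v. v) = \<alpha> * s (p j) \<omega>"
      unfolding \<alpha>_def using p by (intro expectation_x_pmf) (auto simp: reports_def)
    finally show ?thesis .
  qed
  have "exp_profit (private_wagering s \<epsilon>) p m \<omega> i =
      measure_pmf.expectation P
        (\<lambda>x. m i * (\<alpha> * s (p i) \<omega> - (\<Sum>j\<in>UNIV. m j * x j) / (\<Sum>j\<in>UNIV. m j)))"
    by (simp add: exp_profit_def private_wagering_def Let_def P_def \<alpha>_def)
  also have "\<dots> = m i * (\<alpha> * s (p i) \<omega> -
      (\<Sum>j\<in>UNIV. m j * measure_pmf.expectation P (\<lambda>x. x j)) / (\<Sum>j\<in>UNIV. m j))"
    by (simp add: int Bochner_Integration.integral_diff Bochner_Integration.integral_sum)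
  also have "\<dots> = \<alpha> * weighted_score_payoff m (\<lambda>j. s (p j) \<omega>) i"
    unfolding comp weighted_score_payoff_def
    by (simp add: algebra_simps sum_distrib_left)
  finally show ?thesis by (simp add: \<alpha>_def)
qed

text \<open>The payoff is linear in the scores, so averaging over the outcome can be moved inside,
  onto the scores.\<close>

lemma exp_profit_under_private_wagering:
  fixes p :: "'n :: finite \<Rightarrow> real"
  assumes p: "p \<in> reports" and q: "q \<in> {0..1}"
  shows "exp_profit_under q (private_wagering s \<epsilon>) p m i =
    (1 - exp (- \<epsilon>)) * weighted_score_payoff m (\<lambda>j. expected_score s q (p j)) i"
proof -
  have fin: "finite (set_pmf (private_wagering s \<epsilon> p m \<omega>))" for \<omega>
    by (simp add: private_wagering_def Let_def finite_set_noise)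
  have "exp_profit_under q (private_wagering s \<epsilon>) p m i =
      (\<Sum>\<omega>\<in>UNIV. pmf (bernoulli_pmf q) \<omega> *\<^sub>R exp_profit (private_wagering s \<epsilon>) p m \<omega> i)"
    unfolding exp_profit_under_def exp_profit_def
    by (rule pmf_expectation_bind) (auto simp: fin)
  also have "\<dots> = (1 - exp (- \<epsilon>)) * (q * weighted_score_payoff m (\<lambda>j. s (p j) True) i
      + (1 - q) * weighted_score_payoff m (\<lambda>j. s (p j) False) i)"
    using q by (simp add: UNIV_bool exp_profit_private_wagering[OF p] algebra_simps)
  also have "q * weighted_score_payoff m (\<lambda>j. s (p j) True) i
      + (1 - q) * weighted_score_payoff m (\<lambda>j. s (p j) False) i =
      weighted_score_payoff m (\<lambda>j. expected_score s q (p j)) i"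
  proof -
    have sum: "(\<Sum>j\<in>UNIV. m j * expected_score s q (p j)) =
        q * (\<Sum>j\<in>UNIV. m j * s (p j) True) + (1 - q) * (\<Sum>j\<in>UNIV. m j * s (p j) False)"
      by (simp add: expected_score_def sum_distrib_left distrib_left mult.left_commute
          flip: sum.distrib)
    show ?thesis
      unfolding weighted_score_payoff_def sum unfolding expected_score_def
      by (simp add: add_divide_distrib algebra_simps diff_divide_distrib)
  qed
  finally show ?thesis .
qed

lemma \<alpha>_pos: "0 < 1 - exp (- \<epsilon>)"
  using \<epsilon> by simp

lemma reports_upd: "p \<in> reports \<Longrightarrow> r \<in> {0..1} \<Longrightarrow> p(i := r) \<in> reports"
  by (auto simp: reports_def)

section \<open>The eight properties\<close>

lemma budget_balanced_private_wagering:
  "budget_balanced_in_expectation (private_wagering s \<epsilon> :: 'n :: finite mechanism)"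
  unfolding budget_balanced_in_expectation_def
proof (intro ballI allI)
  fix p m :: "'n \<Rightarrow> real" and \<omega>
  assume p: "p \<in> reports" and m: "m \<in> wagers"
  show "(\<Sum>i\<in>UNIV. exp_profit (private_wagering s \<epsilon>) p m \<omega> i) = 0"
    unfolding exp_profit_private_wagering[OF p] sum_distrib_left[symmetric]
      sum_weighted_score_payoff[OF m] by simp
qed

text \<open>Relabelling bettors permutes the independent noise coordinates and leaves the total
  wager unchanged; the weighted noise sum is only reindexed.\<close>

lemma anonymous_private_wagering: "anonymous (private_wagering s \<epsilon> :: 'n :: finite mechanism)"
  unfolding anonymous_def
proof (intro allI impI ballI)
  fix \<sigma> :: "'n \<Rightarrow> 'n" and p m :: "'n \<Rightarrow> real" and \<omega>
  assume \<sigma>: "bij \<sigma>"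
  have inv: "inv \<sigma> (\<sigma> i) = i" for i using \<sigma> by (simp add: bij_is_inj)
  have reindex: "(\<Sum>j\<in>UNIV. f (\<sigma> j)) = (\<Sum>j\<in>UNIV. f j)" for f :: "'n \<Rightarrow> real"
    using \<sigma> by (rule sum.reindex_bij_betw)
  have M: "(\<Sum>j\<in>UNIV. m (inv \<sigma> j)) = (\<Sum>j\<in>UNIV. m j)"
    using reindex[of "\<lambda>j. m (inv \<sigma> j)"] by (simp add: inv)
  have X: "(\<Sum>j\<in>UNIV. m (inv \<sigma> j) * x j) = (\<Sum>j\<in>UNIV. m j * x (\<sigma> j))" for x
    using reindex[of "\<lambda>j. m (inv \<sigma> j) * x j"] by (simp add: inv)
  show "private_wagering s \<epsilon> p m \<omega> = map_pmf (\<lambda>y i. y (\<sigma> i))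
      (private_wagering s \<epsilon> (\<lambda>l. p (inv \<sigma> l)) (\<lambda>l. m (inv \<sigma> l)) \<omega>)"
    unfolding private_wagering_def Let_def
    by (subst Pi_pmf_reindex[OF \<sigma>]) (simp add: map_pmf_comp inv M X)
qed

lemma truthful_private_wagering:
  assumes "strictly_proper s"
  shows "truthful (private_wagering s \<epsilon> :: 'n :: finite mechanism)"
  unfolding truthful_def
proof (intro allI ballI impI)
  fix i :: 'n and p m :: "'n \<Rightarrow> real" and q r :: real
  assume p: "p \<in> reports" and m: "m \<in> wagers" and q: "q \<in> {0..1}" and r: "r \<in> {0..1}"
    and stake: "0 < m i \<and> (\<exists>j. j \<noteq> i \<and> 0 < m j)" and "r \<noteq> q"
  then obtain j where "j \<noteq> i" "0 < m j" by blast
  then have "weighted_score_payoff m (\<lambda>k. expected_score s q ((p(i := r)) k)) i <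
      weighted_score_payoff m (\<lambda>k. expected_score s q ((p(i := q)) k)) i"
    using m stake strictly_properD[OF assms q r \<open>r \<noteq> q\<close>]
    by (intro weighted_score_payoff_strict_mono[of m i j]) auto
  then show "exp_profit_under q (private_wagering s \<epsilon>) (p(i := r)) m i <
      exp_profit_under q (private_wagering s \<epsilon>) (p(i := q)) m i"
    unfolding exp_profit_under_private_wagering[OF reports_upd[OF p r] q]
      exp_profit_under_private_wagering[OF reports_upd[OF p q] q]
    by (intro mult_strict_left_mono \<alpha>_pos)
qed

lemma individually_rational_private_wagering:
  assumes "strictly_proper s"
  shows "individually_rational (private_wagering s \<epsilon> :: 'n :: finite mechanism)"
  unfolding individually_rational_def
proof (intro allI ballI impI)
  fix i :: 'n and w q :: real
  assume w: "0 < w" and q: "q \<in> {0..1}"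
  \<comment> \<open>The witness is the truthful report \<open>q\<close>: by strict propriety no
    report of another bettor has a higher expected score under \<open>q\<close>.\<close>
  have "0 \<le> exp_profit_under q (private_wagering s \<epsilon>) (p(i := q)) (m(i := w)) i"
    if p: "p \<in> reports" and m: "m \<in> wagers" for p m :: "'n \<Rightarrow> real"
  proof -
    have "m(i := w) \<in> wagers" using m w by (auto simp: wagers_def)
    moreover have "expected_score s q (p j) \<le> expected_score s q q" for j
      using strictly_properD[OF assms q, of "p j"] p
      by (cases "p j = q") (auto simp: reports_def intro: less_imp_le)
    ultimately show ?thesis
      unfolding exp_profit_under_private_wagering[OF reports_upd[OF p q] q]
      using \<alpha>_pos by (intro mult_nonneg_nonneg weighted_score_payoff_nonneg) auto
  qed
  then show "\<exists>r\<in>{0..1}. \<forall>p\<in>reports. \<forall>m\<in>wagers.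
      0 \<le> exp_profit_under q (private_wagering s \<epsilon>) (p(i := r)) (m(i := w)) i"
    using q by blast
qed

text \<open>A gain for \<open>j\<close> can only come from a higher expected score of
  \<open>j\<close>, and that score lowers, or leaves unchanged, the payoff of everyone else.\<close>

lemma normal_private_wagering:
  "normal_mechanism (private_wagering s \<epsilon> :: 'n :: finite mechanism)"
  unfolding normal_mechanism_def
proof (intro allI ballI impI)
  fix i j :: 'n and p p' m :: "'n \<Rightarrow> real" and q :: real
  assume ij: "i \<noteq> j" and p: "p \<in> reports" and p': "p' \<in> reports"
    and same: "\<forall>k. k \<noteq> j \<longrightarrow> p' k = p k" and q: "q \<in> {0..1}" and m: "m \<in> wagers"
    and less: "exp_profit_under q (private_wagering s \<epsilon>) p m j <
      exp_profit_under q (private_wagering s \<epsilon>) p' m j"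
  define t where "t = (\<lambda>k. expected_score s q (p k))"
  define t' where "t' = (\<lambda>k. expected_score s q (p' k))"
  have same': "t' k = t k" if "k \<noteq> j" for k
    using that same by (simp add: t_def t'_def)
  have "weighted_score_payoff m t j < weighted_score_payoff m t' j"
    using less
    unfolding exp_profit_under_private_wagering[OF p q] exp_profit_under_private_wagering[OF p' q]
      mult_less_cancel_left_pos[OF \<alpha>_pos] t_def t'_def .
  then have "t j \<le> t' j"
    using weighted_score_payoff_mono[OF m, of j t t'] same' by fastforce
  then have "weighted_score_payoff m t' i \<le> weighted_score_payoff m t i"
    using same' ij by (intro weighted_score_payoff_antimono[OF m]) auto
  then show "exp_profit_under q (private_wagering s \<epsilon>) p' m i \<le>
      exp_profit_under q (private_wagering s \<epsilon>) p m i"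
    unfolding exp_profit_under_private_wagering[OF p q] exp_profit_under_private_wagering[OF p' q]
      mult_le_cancel_left_pos[OF \<alpha>_pos] t_def t'_def .
qed

lemma sybilproof_private_wagering: "sybilproof (private_wagering s \<epsilon> :: 'n :: finite mechanism)"
  unfolding sybilproof_def
proof (intro allI ballI impI)
  fix S :: "'n set" and p m m' :: "'n \<Rightarrow> real" and \<omega>
  assume p: "p \<in> reports" and eq: "\<forall>i\<in>S. \<forall>j\<in>S. p i = p j"
    and m: "(\<forall>i. i \<notin> S \<longrightarrow> m i = m' i) \<and> (\<Sum>i\<in>S. m i) = (\<Sum>i\<in>S. m' i)"
  have t: "s (p i) \<omega> = s (p j) \<omega>" if "i \<in> S" "j \<in> S" for i j using eq that by metis
  show "(\<forall>i. i \<notin> S \<longrightarrow> exp_profit (private_wagering s \<epsilon>) p m \<omega> i =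
        exp_profit (private_wagering s \<epsilon>) p m' \<omega> i) \<and>
      (\<Sum>i\<in>S. exp_profit (private_wagering s \<epsilon>) p m \<omega> i) =
      (\<Sum>i\<in>S. exp_profit (private_wagering s \<epsilon>) p m' \<omega> i)"
    using weighted_score_payoff_cong_sybils[of S "\<lambda>k. s (p k) \<omega>" m m', OF t] m
    by (simp add: exp_profit_private_wagering[OF p] flip: sum_distrib_left)
qed

lemma monotonic_private_wagering: "monotonic (private_wagering s \<epsilon> :: 'n :: finite mechanism)"
  unfolding monotonic_def Let_def
proof (intro allI ballI impI)
  fix i :: 'n and p m :: "'n \<Rightarrow> real" and M q :: real
  assume p: "p \<in> reports" and m: "m \<in> wagers" and M: "m i < M" and q: "q \<in> {0..1}"
    and pos: "0 < m i"
  let ?E = "exp_profit_under q (private_wagering s \<epsilon>) p m i"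
  let ?E' = "exp_profit_under q (private_wagering s \<epsilon>) p (m(i := M)) i"
  show "0 < ?E \<and> ?E < ?E' \<or> ?E < 0 \<and> ?E' < ?E \<or> 0 = ?E \<and> ?E = ?E'"
    using weighted_score_payoff_increase_wager[OF m pos M, of "\<lambda>k. expected_score s q (p k)"] \<alpha>_pos
    unfolding exp_profit_under_private_wagering[OF p q]
    by (auto simp: zero_less_mult_iff mult_less_0_iff)
qed

text \<open>This is post-processing: the others' profits are a fixed function of the noise vector,
  whose law changes only in coordinate \<open>i\<close> when \<open>i\<close> changes her
  report.\<close>

lemma joint_differentially_private_private_wagering:
  "joint_differentially_private \<epsilon> (private_wagering s \<epsilon> :: 'n :: finite mechanism)"
  unfolding joint_differentially_private_def
proof (intro allI ballI)
  fix i :: 'n and p m :: "'n \<Rightarrow> real" and r :: real and \<omega> and A :: "('n \<Rightarrow> real) set"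
  assume p: "p \<in> reports" and r: "r \<in> {0..1}"
  define F where "F u x = restrict (\<lambda>k. m k * ((1 - exp (- \<epsilon>)) * s (u k) \<omega> -
      (\<Sum>j\<in>UNIV. m j * x j) / (\<Sum>j\<in>UNIV. m j))) (- {i})" for u x :: "'n \<Rightarrow> real"
  define X where "X = (\<lambda>j. x_pmf s \<epsilon> (p j) \<omega>)"
  have law: "map_pmf (\<lambda>y. restrict y (- {i})) (private_wagering s \<epsilon> u m \<omega>) =
      map_pmf (F u) (Pi_pmf UNIV 0 (\<lambda>j. x_pmf s \<epsilon> (u j) \<omega>))" for u
    by (simp add: private_wagering_def Let_def map_pmf_comp F_def[abs_def])
  \<comment> \<open>The report of \<open>i\<close> enters \<open>F\<close> directly only through
    coordinate \<open>i\<close>, which the restriction to \<open>- {i}\<close> discards.\<close>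
  have F: "F (p(i := r)) = F p"
    by (intro ext) (simp add: F_def restrict_def)
  have X: "(\<lambda>j. x_pmf s \<epsilon> ((p(i := r)) j) \<omega>) = X(i := x_pmf s \<epsilon> r \<omega>)"
    by (auto simp: X_def)
  have "measure_pmf.prob (Pi_pmf UNIV 0 X) B \<le>
      exp \<epsilon> * measure_pmf.prob (Pi_pmf UNIV 0 (X(i := x_pmf s \<epsilon> r \<omega>))) B" for B
    using p r unfolding X_def
    by (intro measure_pmf_le_mult_measure_pmf pmf_Pi_pmf_upd_le pmf_x_pmf_le)
      (auto simp: reports_def)
  then show "measure_pmf.prob (map_pmf (\<lambda>y. restrict y (- {i})) (private_wagering s \<epsilon> p m \<omega>)) A \<le>
      exp \<epsilon> * measure_pmf.prob
        (map_pmf (\<lambda>y. restrict y (- {i})) (private_wagering s \<epsilon> (p(i := r)) m \<omega>)) A"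
    unfolding law F X by (simp add: X_def)
qed

end

theorem theorem2:
  fixes \<epsilon> :: real and s :: "real \<Rightarrow> bool \<Rightarrow> real" and W :: "'n :: finite mechanism"
  assumes "\<epsilon> > 0"
    and "\<And>p \<omega>. p \<in> {0..1} \<Longrightarrow> s p \<omega> \<in> {0..1}"
    and "strictly_proper s"
    and "W = private_wagering s \<epsilon>"
  shows "budget_balanced_in_expectation W \<and> anonymous W \<and> truthful W \<and>
    individually_rational W \<and> normal_mechanism W \<and> sybilproof W \<and> monotonic W \<and>
    joint_differentially_private \<epsilon> W"
  unfolding assms(4)
  by (intro conjI budget_balanced_private_wagering anonymous_private_wagering
      truthful_private_wagering individually_rational_private_wagering normal_private_wagering
      sybilproof_private_wagering monotonic_private_wagering
      joint_differentially_private_private_wagering assms(1-3))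

end
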